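(* Let $R$ be a local ring with a non-archimedean absolute value $|\cdot|$, and suppose $f\colon R^n\to R^n$ is a function defined by power series with coefficients in $R$ which converge on $R^n$. Fix $x_0\in R^n$ and a matrix $T\in \mathrm{GL}_n(R)$, and suppose that for some real number $0\le\lambda<1$ we have \begin{enumerate} \item $|f(x_0)|\le\lambda$, and \item $|T-J_f(x_0)|\le\lambda$, where $J_f$ is the Jacobian matrix of $f$. \end{enumerate} Consider the sequence $(x_m)_{m\ge 0}$ defined by $x_{m+1}=x_m-T^{-1}f(x_m)$. Then we have, for all $m\ge 0$: \begin{enumerate} \item $|f(x_m)|\le\lambda^{m+1}$, and \item $|x_m-x_0|<1$. \end{enumerate} In particular, the sequence $(x_m)$ converges to a root of $f$.
   Context: On vectors in $R^n$ and on $n\times n$ matrices over $R$, $|\cdot|$ denotes the maximum of the absolute values of the entries.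
   Formalization: The formal version assumes |r| ≤ 1 for all r in R, that the entries of J_f(x_0) converge in R, and, for the final claim that (x_m) converges to a root, that R is complete; without the bound or completeness the claim fails (e.g. over Q_p or Z_(2)). *)

theory Defs
  imports "HOL-Analysis.Analysis"
begin

text \<open>
  The topology used for limits, infinite sums and completeness is the one of the metric
  \<open>dist x y = absval (x - y)\<close>. The normed classes of the library cannot be used,
  as they require an algebra over the reals.
\<close>

class nonarch_absval_ring = comm_ring_1 + metric_space +
  fixes absval :: "'a \<Rightarrow> real"
  assumes dist_absval: "dist x y = absval (x - y)"
    and absval_nonneg: "0 \<le> absval x"
    and absval_eq_0_iff: "absval x = 0 \<longleftrightarrow> x = 0"
    and absval_mult: "absval (x * y) = absval x * absval y"
    and absval_ultrametric: "absval (x + y) \<le> max (absval x) (absval y)"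

definition is_ideal :: "'a::comm_ring_1 set \<Rightarrow> bool" where
  "is_ideal I \<longleftrightarrow> 0 \<in> I \<and> (\<forall>x\<in>I. \<forall>y\<in>I. x + y \<in> I) \<and> (\<forall>r. \<forall>x\<in>I. r * x \<in> I)"

definition is_maximal_ideal :: "'a::comm_ring_1 set \<Rightarrow> bool" where
  "is_maximal_ideal M \<longleftrightarrow>
     is_ideal M \<and> M \<noteq> UNIV \<and> (\<forall>I. is_ideal I \<and> M \<subseteq> I \<and> I \<noteq> UNIV \<longrightarrow> I = M)"

definition is_local_ring :: "'a::comm_ring_1 itself \<Rightarrow> bool" where
  "is_local_ring _ \<longleftrightarrow> (\<exists>!M :: 'a set. is_maximal_ideal M)"

definition vec_absval :: "'a::nonarch_absval_ring ^ 'n \<Rightarrow> real" where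
  "vec_absval v = Max (range (\<lambda>i. absval (v $ i)))"

definition mat_absval :: "'a::nonarch_absval_ring ^ 'n ^ 'm \<Rightarrow> real" where
  "mat_absval A = Max (range (\<lambda>(i, j). absval (A $ i $ j)))"

text \<open>
  A power series in the variables \<open>X\<^sub>j\<close>, \<open>j :: 'n\<close>, is given by its family of coefficients
  \<open>c :: ('n \<Rightarrow> nat) \<Rightarrow> 'a\<close>, indexed by the exponents of the monomials. Its convergence is the
  unconditional one, along the finite sets of exponents.
\<close>

definition pseries_has_value ::
    "(('n::finite \<Rightarrow> nat) \<Rightarrow> 'a::nonarch_absval_ring) \<Rightarrow> 'a ^ 'n \<Rightarrow> 'a \<Rightarrow> bool" where
  "pseries_has_value c x y \<longleftrightarrow> ((\<lambda>\<alpha>. c \<alpha> * (\<Prod>j\<in>UNIV. x $ j ^ \<alpha> j)) has_sum y) UNIV"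

text \<open>
  The formal partial derivative with respect to \<open>X\<^sub>j\<close>: its coefficient at \<open>X\<^sup>\<alpha>\<close> is
  \<open>\<alpha>\<^sub>j + 1\<close> times the coefficient of the given series at \<open>X\<^sup>\<alpha> X\<^sub>j\<close>.
\<close>

definition pseries_partial ::
    "'n \<Rightarrow> (('n \<Rightarrow> nat) \<Rightarrow> 'a::comm_ring_1) \<Rightarrow> ('n \<Rightarrow> nat) \<Rightarrow> 'a" where
  "pseries_partial j c = (\<lambda>\<alpha>. of_nat (\<alpha> j + 1) * c (\<alpha>(j := \<alpha> j + 1)))"

definition defined_by_pseries ::
    "('a::nonarch_absval_ring ^ 'n::finite \<Rightarrow> 'a ^ 'n) \<Rightarrow> ('n \<Rightarrow> ('n \<Rightarrow> nat) \<Rightarrow> 'a) \<Rightarrow> bool" where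
  "defined_by_pseries f c \<longleftrightarrow> (\<forall>x i. pseries_has_value (c i) x (f x $ i))"

text \<open>
  The matrix \<open>J\<close> is the value at \<open>x\<close> of the Jacobian matrix of the function defined by the
  series \<open>c i\<close>. Lemma \<open>ex1_jacobian\<close> below shows that over a complete ring whose elements have
  absolute value at most 1 this value always exists and is unique.
\<close>

definition has_jacobian_at ::
    "('n::finite \<Rightarrow> ('n \<Rightarrow> nat) \<Rightarrow> 'a::nonarch_absval_ring) \<Rightarrow> 'a ^ 'n ^ 'n \<Rightarrow> 'a ^ 'n \<Rightarrow> bool" where
  "has_jacobian_at c J x \<longleftrightarrow> (\<forall>i j. pseries_has_value (pseries_partial j (c i)) x (J $ i $ j))"

lemma absval_sum_less:
  fixes g :: "'b \<Rightarrow> 'a::nonarch_absval_ring"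
  assumes "\<And>a. a \<in> A \<Longrightarrow> absval (g a) < e" "0 < e"
  shows "absval (sum g A) < e"
  using assms
proof (induction A rule: infinite_finite_induct)
  case (insert a A)
  then have "absval (g a) < e" "absval (sum g A) < e" by auto
  then show ?case
    using insert.hyps absval_ultrametric[of "g a" "sum g A"] by simp
qed (use absval_eq_0_iff[of "0::'a"] in simp_all)

lemma summable_on_imp_finite_large:
  fixes g :: "'b \<Rightarrow> 'a::nonarch_absval_ring"
  assumes "(g has_sum s) UNIV" "0 < e"
  shows "finite {a. e \<le> absval (g a)}"
proof -
  have "eventually (\<lambda>F. dist (sum g F) s < e / 2) (finite_subsets_at_top UNIV)"
    using assms(1) half_gt_zero[OF assms(2)] unfolding has_sum_def tendsto_iff by blast
  then obtain F where F: "finite F" "\<And>G. finite G \<Longrightarrow> F \<subseteq> G \<Longrightarrow> dist (sum g G) s < e / 2"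
    unfolding eventually_finite_subsets_at_top by auto
  have "absval (g a) < e" if "a \<notin> F" for a
  proof -
    have "absval (g a) = dist (sum g (insert a F)) (sum g F)"
      using F(1) that by (simp add: dist_absval)
    also have "\<dots> \<le> dist (sum g (insert a F)) s + dist (sum g F) s"
      by (rule dist_triangle2)
    also have "\<dots> < e"
      using F(2)[OF F(1) order_refl] F(2)[OF _ subset_insertI, of a] F(1) by simp
    finally show ?thesis .
  qed
  then have "{a. e \<le> absval (g a)} \<subseteq> F" by force
  then show ?thesis using F(1) finite_subset by blast
qed

lemma finite_large_imp_summable_on:
  fixes g :: "'b \<Rightarrow> 'a::nonarch_absval_ring"
  assumes "complete (UNIV :: 'a set)"
    and fin: "\<And>e. 0 < e \<Longrightarrow> finite {a. e \<le> absval (g a)}"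
  shows "g summable_on UNIV"
proof -
  have "\<exists>P. eventually P (finite_subsets_at_top UNIV) \<and>
          (\<forall>F G. P F \<and> P G \<longrightarrow> dist (sum g F) (sum g G) < e)" if "0 < e" for e :: real
  proof (intro exI[of _ "\<lambda>F. finite F \<and> {a. e \<le> absval (g a)} \<subseteq> F"] conjI allI impI)
    show "eventually (\<lambda>F. finite F \<and> {a. e \<le> absval (g a)} \<subseteq> F) (finite_subsets_at_top UNIV)"
      unfolding eventually_finite_subsets_at_top using fin[OF that] by auto
  next
    fix F G
    assume H: "(finite F \<and> {a. e \<le> absval (g a)} \<subseteq> F) \<and> (finite G \<and> {a. e \<le> absval (g a)} \<subseteq> G)"
    have "sum g F = sum g (F - G) + sum g (F \<inter> G)" "sum g G = sum g (G - F) + sum g (F \<inter> G)"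
      using H by (metis sum.Int_Diff add.commute, metis sum.Int_Diff add.commute Int_commute)
    then have eq: "sum g F - sum g G = sum g (F - G) + sum (\<lambda>a. - g a) (G - F)"
      by (simp add: sum_negf)
    have neg: "absval (- y) = absval y" for y :: 'a
      by (metis dist_absval dist_commute diff_0 diff_0_right)
    have "absval (sum g (F - G)) < e" "absval (sum (\<lambda>a. - g a) (G - F)) < e"
      using H that by (intro absval_sum_less; force simp: neg)+
    then show "dist (sum g F) (sum g G) < e"
      unfolding dist_absval eq
      using absval_ultrametric[of "sum g (F - G)" "sum (\<lambda>a. - g a) (G - F)"] by simp
  qed
  then have "cauchy_filter (filtermap (sum g) (finite_subsets_at_top UNIV))"
    by (simp add: cauchy_filter_metric_filtermap)
  then obtain s where "(sum g \<longlongrightarrow> s) (finite_subsets_at_top UNIV)"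
    using complete_uniform[where S = "UNIV :: 'a set"] assms(1) by (force simp add: filterlim_def)
  then show ?thesis
    unfolding summable_on_def has_sum_def by blast
qed

lemma ex1_jacobian:
  fixes f :: "'a::nonarch_absval_ring ^ 'n::finite \<Rightarrow> 'a ^ 'n"
  assumes "complete (UNIV :: 'a set)" and le1: "\<And>r :: 'a. absval r \<le> 1"
    and f: "defined_by_pseries f c"
  shows "\<exists>!J. has_jacobian_at c J x"
proof -
  have summable: "(\<lambda>\<alpha>. pseries_partial j (c i) \<alpha> * (\<Prod>k\<in>UNIV. x $ k ^ \<alpha> k)) summable_on UNIV"
    for i j
  proof (rule finite_large_imp_summable_on[OF assms(1)])
    fix e :: real
    assume "0 < e"
    have "(c i has_sum f (\<chi> k. 1) $ i) UNIV"
      using f[unfolded defined_by_pseries_def pseries_has_value_def, rule_format, of i "\<chi> k. 1"]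
      by simp
    then have fin: "finite {\<alpha>. e \<le> absval (c i \<alpha>)}"
      using \<open>0 < e\<close> by (rule summable_on_imp_finite_large)
    have le: "absval (r * y * s) \<le> absval y" for r y s :: 'a
    proof -
      have "absval (r * y * s) = (absval r * absval s) * absval y"
        by (simp add: absval_mult)
      also have "\<dots> \<le> 1 * absval y"
        by (intro mult_right_mono mult_le_one le1 absval_nonneg)
      finally show ?thesis by simp
    qed
    let ?u = "\<lambda>\<alpha>::'n \<Rightarrow> nat. \<alpha>(j := \<alpha> j + 1)"
    have "inj ?u"
      by (rule injI) (metis add_right_cancel fun_upd_same fun_upd_triv fun_upd_upd)
    then have "finite (?u -` {\<alpha>. e \<le> absval (c i \<alpha>)})"
      using fin by (rule finite_vimageI[rotated])
    then show "finite {\<alpha>. e \<le> absval (pseries_partial j (c i) \<alpha> * (\<Prod>k\<in>UNIV. x $ k ^ \<alpha> k))}"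
      by (rule finite_subset[rotated])
        (use le in \<open>auto simp: pseries_partial_def intro: order_trans\<close>)
  qed
  show ?thesis
  proof (rule ex1I)
    show "has_jacobian_at c (\<chi> i j.
            \<Sum>\<^sub>\<infinity>\<alpha>. pseries_partial j (c i) \<alpha> * (\<Prod>k\<in>UNIV. x $ k ^ \<alpha> k)) x"
      using summable by (simp add: has_jacobian_at_def pseries_has_value_def has_sum_infsum)
  next
    fix J
    assume "has_jacobian_at c J x"
    then show "J = (\<chi> i j.
            \<Sum>\<^sub>\<infinity>\<alpha>. pseries_partial j (c i) \<alpha> * (\<Prod>k\<in>UNIV. x $ k ^ \<alpha> k))"
      by (simp add: has_jacobian_at_def pseries_has_value_def vec_eq_iff infsumI[symmetric])
  qed
qed

end

theory Submission
  imports Defs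
begin

text \<open>
  Since all elements of the ring have absolute value at most 1, every monomial, and hence
  every series \<open>c i\<close>, satisfies the first-order estimate
  \<open>|f (x + h) - f x - J h| \<le> l M\<close> whenever \<open>|x - x0| \<le> l\<close> and \<open>|h| \<le> M \<le> l\<close>, where \<open>J\<close> is the
  Jacobian at the fixed point \<open>x0\<close>. Expanding around \<open>x0\<close> rather than \<open>x\<close> matters: without
  completeness the Jacobian at \<open>x\<close> need not exist. For a Newton step \<open>h\<close> at \<open>x\<close> we have
  \<open>T h = - f x\<close>, so \<open>f (x + h)\<close> is \<open>(J - T) h\<close> up to an error of size \<open>l M\<close>, and each step
  gains a factor \<open>l\<close>.
\<close>

section \<open>Topology of the ring and ultrametric bounds\<close>

lemma absval_minus [simp]: "absval (- y) = absval (y :: 'a::nonarch_absval_ring)"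
  by (metis dist_absval dist_commute diff_0 diff_0_right)

text \<open>This makes the general rules for adding and negating infinite sums available over the
  ring.\<close>

instance nonarch_absval_ring \<subseteq> topological_ab_group_add
proof
  fix a b :: 'a
  show "LIM x (nhds a \<times>\<^sub>F nhds b). fst x + snd x :> nhds (a + b)"
  proof (rule tendstoI)
    fix e :: real
    assume "0 < e"
    then have "\<forall>\<^sub>F x in nhds a. dist x a < e" "\<forall>\<^sub>F y in nhds b. dist y b < e"
      by (auto simp: eventually_nhds_metric)
    then have "\<forall>\<^sub>F x in nhds a \<times>\<^sub>F nhds b. dist (fst x) a < e \<and> dist (snd x) b < e"
      unfolding eventually_prod_filter by fastforce
    then show "\<forall>\<^sub>F x in nhds a \<times>\<^sub>F nhds b. dist (fst x + snd x) (a + b) < e"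
    proof eventually_elim
      case (elim x)
      then show ?case
        \<comment> \<open>The ultrametric inequality lets both summands use the full
          \<open>e\<close>, without halving.\<close>
        using le_less_trans[OF absval_ultrametric[of "fst x - a" "snd x - b"], of e]
        by (simp add: dist_absval add_diff_add)
    qed
  qed
  show "(uminus \<longlongrightarrow> - a) (nhds a)"
  proof (rule tendstoI)
    fix e :: real
    assume "0 < e"
    then have "\<forall>\<^sub>F x in nhds a. dist x a < e"
      by (auto simp: eventually_nhds_metric)
    then show "\<forall>\<^sub>F x in nhds a. dist (- x) (- a) < e"
    proof eventually_elim
      case (elim x)
      then show ?case
        using absval_minus[of "x - a"] by (simp add: dist_absval)
    qed
  qed
qed

lemma absval_0 [simp]: "absval (0 :: 'a::nonarch_absval_ring) = 0"
  by (simp add: absval_eq_0_iff)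

lemma absval_add_le:
  fixes x y :: "'a::nonarch_absval_ring"
  shows "absval x \<le> r \<Longrightarrow> absval y \<le> r \<Longrightarrow> absval (x + y) \<le> r"
  using absval_ultrametric[of x y] by simp

lemma absval_diff_le:
  fixes x y :: "'a::nonarch_absval_ring"
  shows "absval x \<le> r \<Longrightarrow> absval y \<le> r \<Longrightarrow> absval (x - y) \<le> r"
  using absval_add_le[of x r "- y"] by simp

lemma absval_sum_le:
  fixes g :: "'b \<Rightarrow> 'a::nonarch_absval_ring"
  assumes "\<And>a. a \<in> A \<Longrightarrow> absval (g a) \<le> r" "0 \<le> r"
  shows "absval (sum g A) \<le> r"
  using assms by (induction A rule: infinite_finite_induct) (auto intro: absval_add_le)

lemma absval_mult_le:
  fixes x y :: "'a::nonarch_absval_ring"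
  assumes "absval x \<le> r" "absval y \<le> s"
  shows "absval (x * y) \<le> r * s"
proof -
  have "0 \<le> r" using assms(1) absval_nonneg[of x] by linarith
  then show ?thesis
    using assms by (simp add: absval_mult mult_mono absval_nonneg)
qed

lemma closed_absval_diff_le: "closed {y :: 'a::nonarch_absval_ring. absval (y - a) \<le> r}"
proof -
  have "{y. absval (y - a) \<le> r} = cball a r"
    by (auto simp: dist_absval[symmetric] dist_commute)
  then show ?thesis by simp
qed

section \<open>Infinite sums\<close>

text \<open>Finite partial sums obey the bound however many terms they have, and closed balls keep
  it in the limit.\<close>

lemma absval_has_sum_le:
  fixes g :: "'b \<Rightarrow> 'a::nonarch_absval_ring"
  assumes "(g has_sum s) A" "\<And>a. a \<in> A \<Longrightarrow> absval (g a) \<le> r" "0 \<le> r"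
  shows "absval s \<le> r"
proof -
  have "s \<in> {y. absval (y - 0) \<le> r}"
  proof (rule Lim_in_closed_set[OF closed_absval_diff_le])
    show "(sum g \<longlongrightarrow> s) (finite_subsets_at_top A)"
      using assms(1) by (simp add: has_sum_def)
    show "\<forall>\<^sub>F F in finite_subsets_at_top A. sum g F \<in> {y. absval (y - 0) \<le> r}"
      using assms(2,3)
      by (auto intro!: eventually_finite_subsets_at_top_weakI absval_sum_le)
  qed simp
  then show ?thesis by simp
qed

lemma has_sum_mult_right:
  fixes g :: "'b \<Rightarrow> 'a::nonarch_absval_ring"
  assumes "(g has_sum s) A"
  shows "((\<lambda>a. g a * y) has_sum s * y) A"
proof -
  have "((\<lambda>F. absval (sum g F - s)) \<longlongrightarrow> 0) (finite_subsets_at_top A)"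
    using assms by (simp add: has_sum_def tendsto_dist_iff[of _ s] dist_absval)
  then have "((\<lambda>F. absval (sum g F - s) * absval y) \<longlongrightarrow> 0) (finite_subsets_at_top A)"
    by (rule tendsto_mult_left_zero)
  then have "((\<lambda>F. sum g F * y) \<longlongrightarrow> s * y) (finite_subsets_at_top A)"
    by (simp add: tendsto_dist_iff[of _ "s * y"] dist_absval absval_mult[symmetric]
        left_diff_distrib)
  then show ?thesis
    by (simp add: has_sum_def sum_distrib_right)
qed

lemma has_sum_sum_family:
  fixes g :: "'c \<Rightarrow> 'b \<Rightarrow> 'a::topological_comm_monoid_add"
  assumes "\<And>j. j \<in> S \<Longrightarrow> (g j has_sum s j) A"
  shows "((\<lambda>a. \<Sum>j\<in>S. g j a) has_sum (\<Sum>j\<in>S. s j)) A"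
  using assms by (induction S rule: infinite_finite_induct) (auto intro: has_sum_add)

lemma has_sum_minus:
  fixes g g' :: "'b \<Rightarrow> 'a::topological_ab_group_add"
  assumes "(g has_sum s) A" "(g' has_sum s') A"
  shows "((\<lambda>a. g a - g' a) has_sum s - s') A"
  using has_sum_add[OF assms(1), of "\<lambda>a. - g' a" "- s'"] assms(2)
  by (simp add: has_sum_uminus)

section \<open>Maximum norms of vectors and matrices\<close>

lemma vec_absval_le_iff: "vec_absval v \<le> r \<longleftrightarrow> (\<forall>i. absval (v $ i) \<le> r)"
  unfolding vec_absval_def by (subst Max_le_iff) auto

lemma vec_absval_add_le:
  "vec_absval v \<le> r \<Longrightarrow> vec_absval w \<le> r \<Longrightarrow> vec_absval (v + w) \<le> r"
  by (simp add: vec_absval_le_iff absval_add_le)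

lemma vec_absval_diff_le:
  "vec_absval v \<le> r \<Longrightarrow> vec_absval w \<le> r \<Longrightarrow> vec_absval (v - w) \<le> r"
  by (simp add: vec_absval_le_iff absval_diff_le)

lemma mat_absval_le_iff: "mat_absval A \<le> r \<longleftrightarrow> (\<forall>i j. absval (A $ i $ j) \<le> r)"
  unfolding mat_absval_def by (subst Max_le_iff) auto

lemma matrix_vector_mult_absval_le:
  fixes A :: "'a::nonarch_absval_ring ^ 'n ^ 'm"
  assumes "mat_absval A \<le> r" "vec_absval v \<le> s"
  shows "vec_absval (A *v v) \<le> r * s"
proof -
  \<comment> \<open>Index types are nonempty, so some entry forces each bound to be
    nonnegative.\<close>
  have "0 \<le> r" "0 \<le> s"
    using assms absval_nonneg unfolding mat_absval_le_iff vec_absval_le_iff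
    by (meson order_trans)+
  then show ?thesis
    using assms
    by (auto simp: vec_absval_le_iff mat_absval_le_iff matrix_vector_mult_def
        intro!: absval_sum_le absval_mult_le)
qed

lemma mult_matrix_inv:
  assumes "invertible A"
  shows "A ** matrix_inv A = mat 1"
  using someI_ex[OF assms[unfolded invertible_def]] by (simp add: matrix_inv_def)

section \<open>Lipschitz and first-order estimates for monomials\<close>

lemma absval_mult_diff_le:
  fixes a a' b b' :: "'a::nonarch_absval_ring"
  assumes le1: "\<And>r :: 'a. absval r \<le> 1"
    and "absval (a - b) \<le> r" "absval (a' - b') \<le> r"
  shows "absval (a * a' - b * b') \<le> r"
proof -
  have "a * a' - b * b' = (a - b) * a' + b * (a' - b')"
    by (simp add: algebra_simps)
  then show ?thesis
    using absval_mult_le[OF assms(2) le1[of a']] absval_mult_le[OF le1[of b] assms(3)]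
    by (auto intro: absval_add_le)
qed

lemma absval_prod_diff_le:
  fixes a b :: "'b \<Rightarrow> 'a::nonarch_absval_ring"
  assumes le1: "\<And>r :: 'a. absval r \<le> 1"
    and "\<And>j. j \<in> S \<Longrightarrow> absval (a j - b j) \<le> r" "0 \<le> r"
  shows "absval (prod a S - prod b S) \<le> r"
  using assms(2,3)
  by (induction S rule: infinite_finite_induct) (auto intro!: absval_mult_diff_le[OF le1])

lemma absval_power_diff_le:
  fixes a b :: "'a::nonarch_absval_ring"
  assumes le1: "\<And>r :: 'a. absval r \<le> 1" and "absval (a - b) \<le> r" "0 \<le> r"
  shows "absval (a ^ k - b ^ k) \<le> r"
  using absval_prod_diff_le[OF le1, of "{..<k}" "\<lambda>_. a" "\<lambda>_. b" r] assms(2,3) by simp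

text \<open>
  Here \<open>a\<close>, \<open>b\<close>, \<open>p\<close> stand for the values of a polynomial at \<open>x + h\<close>, \<open>x\<close> and \<open>x0\<close>, and \<open>d\<close> for
  its differential at \<open>x0\<close> applied to \<open>h\<close>.
\<close>

definition first_order ::
    "real \<Rightarrow> real \<Rightarrow> 'a::nonarch_absval_ring \<Rightarrow> 'a \<Rightarrow> 'a \<Rightarrow> 'a \<Rightarrow> bool" where
  "first_order l M a b p d \<longleftrightarrow>
     absval (a - b - d) \<le> l * M \<and> absval (b - p) \<le> l \<and> absval d \<le> M"

lemma first_order_1:
  assumes "0 \<le> M" "M \<le> l"
  shows "first_order l M 1 1 1 0"
  using assms by (simp add: first_order_def)

text \<open>This is the product rule. The bounds on \<open>b - p\<close> and \<open>d\<close> are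
  carried along because they control the cross terms of the next product.\<close>

lemma first_order_mult:
  fixes a b p d :: "'a::nonarch_absval_ring"
  assumes le1: "\<And>r :: 'a. absval r \<le> 1" and M: "0 \<le> M" "M \<le> l"
    and 1: "first_order l M a b p d" and 2: "first_order l M a' b' p' d'"
  shows "first_order l M (a * a') (b * b') (p * p') (p * d' + p' * d)"
proof -
  have e: "absval (a - b - d) \<le> l * M" "absval (a' - b' - d') \<le> l * M"
    and q: "absval (b - p) \<le> l" "absval (b' - p') \<le> l"
    and d: "absval d \<le> M" "absval d' \<le> M" "absval d \<le> l"
    using 1 2 M unfolding first_order_def by auto
  \<comment> \<open>The first two terms inherit the errors of the factors, the next two come from
    differentiating at \<open>p\<close> instead of \<open>b\<close>, and \<open>d * d'\<close> is of
    second order, where M \<le> l gives M * M \<le> l * M.\<close>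
  have "a * a' - b * b' - (p * d' + p' * d) =
      (a - b - d) * a' + (b + d) * (a' - b' - d') + (b - p) * d' + (b' - p') * d + d * d'"
    by (simp add: algebra_simps)
  moreover have "absval ((a - b - d) * a') \<le> l * M" "absval ((b + d) * (a' - b' - d')) \<le> l * M"
    using absval_mult_le[OF e(1) le1] absval_mult_le[OF le1 e(2)] by auto
  moreover have "absval ((b - p) * d') \<le> l * M" "absval ((b' - p') * d) \<le> l * M"
      "absval (d * d') \<le> l * M"
    using q d by (simp_all add: absval_mult_le)
  ultimately have "absval (a * a' - b * b' - (p * d' + p' * d)) \<le> l * M"
    by (simp add: absval_add_le)
  moreover have "absval (b * b' - p * p') \<le> l"
    by (rule absval_mult_diff_le[OF le1 q])
  moreover have "absval (p * d' + p' * d) \<le> M"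
    using absval_mult_le[OF le1 d(1)] absval_mult_le[OF le1 d(2)] by (auto intro: absval_add_le)
  ultimately show ?thesis
    by (simp add: first_order_def)
qed

lemma first_order_power:
  fixes a b p d :: "'a::nonarch_absval_ring"
  assumes le1: "\<And>r :: 'a. absval r \<le> 1" and M: "0 \<le> M" "M \<le> l"
    and "first_order l M a b p d"
  shows "first_order l M (a ^ k) (b ^ k) (p ^ k) (of_nat k * p ^ (k - 1) * d)"
proof (induction k)
  case 0
  then show ?case using first_order_1[OF M] by simp
next
  case (Suc k)
  \<comment> \<open>For \<open>k = 0\<close> the exponent is truncated, but both sides
    vanish.\<close>
  have "p * (of_nat k * p ^ (k - 1) * d) = of_nat k * p ^ k * d"
    by (cases k) (simp_all add: algebra_simps)
  then have "p * (of_nat k * p ^ (k - 1) * d) + p ^ k * d = of_nat (Suc k) * p ^ (Suc k - 1) * d"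
    by (simp add: algebra_simps)
  then show ?case
    using first_order_mult[OF le1 M assms(4) Suc] by simp
qed

lemma first_order_prod:
  fixes a b p d :: "'b \<Rightarrow> 'a::nonarch_absval_ring"
  assumes le1: "\<And>r :: 'a. absval r \<le> 1" and M: "0 \<le> M" "M \<le> l" and "finite S"
    and "\<And>j. j \<in> S \<Longrightarrow> first_order l M (a j) (b j) (p j) (d j)"
  shows "first_order l M (prod a S) (prod b S) (prod p S) (\<Sum>j\<in>S. d j * prod p (S - {j}))"
  using assms(4,5)
proof (induction S rule: finite_induct)
  case empty
  then show ?case using first_order_1[OF M] by simp
next
  case (insert i S)
  \<comment> \<open>Pulling out \<open>p i\<close> brings the Leibniz sum over
    \<open>insert i S\<close> into the form of the product rule.\<close>
  have "d j * prod p (insert i S - {j}) = p i * (d j * prod p (S - {j}))" if "j \<in> S" for j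
  proof -
    have "insert i S - {j} = insert i (S - {j})" using that insert.hyps by auto
    then show ?thesis using insert.hyps by (simp add: algebra_simps)
  qed
  then have sum_eq: "(\<Sum>j\<in>insert i S. d j * prod p (insert i S - {j})) =
      p i * (\<Sum>j\<in>S. d j * prod p (S - {j})) + prod p S * d i"
    using insert.hyps by (simp add: sum_distrib_left algebra_simps)
  show ?case
    unfolding sum_eq prod.insert[OF insert.hyps]
    by (intro first_order_mult[OF le1 M] insert) auto
qed

section \<open>Power series and their partial derivatives\<close>

text \<open>Truncated subtraction in \<open>\<alpha> j - 1\<close> is harmless: the factor \<open>of_nat (\<alpha> j)\<close> vanishes then.\<close>

lemma has_sum_pseries_partial:
  fixes c :: "('n::finite \<Rightarrow> nat) \<Rightarrow> 'a::nonarch_absval_ring"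
  assumes "pseries_has_value (pseries_partial j c) x y"
  shows "((\<lambda>\<alpha>. c \<alpha> * (of_nat (\<alpha> j) * x $ j ^ (\<alpha> j - 1) * (\<Prod>k\<in>UNIV - {j}. x $ k ^ \<alpha> k)))
    has_sum y) UNIV"
    (is "(?g has_sum y) UNIV")
proof -
  \<comment> \<open>\<open>?u\<close> multiplies a monomial by the variable of index
    \<open>j\<close>; its range consists of the exponents with positive \<open>j\<close>-th entry,
    the only ones whose derivative term can be nonzero.\<close>
  let ?u = "\<lambda>\<alpha>::'n \<Rightarrow> nat. \<alpha>(j := \<alpha> j + 1)"
  have "inj ?u"
    by (rule injI) (metis add_right_cancel fun_upd_same fun_upd_triv fun_upd_upd)
  moreover have "pseries_partial j c \<alpha> * (\<Prod>k\<in>UNIV. x $ k ^ \<alpha> k) = ?g (?u \<alpha>)" for \<alpha>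
    by (simp add: pseries_partial_def prod.remove[of UNIV j] algebra_simps)
  ultimately have "(?g has_sum y) (range ?u)"
    using assms by (simp add: has_sum_reindex pseries_has_value_def o_def)
  moreover have "?g \<alpha> = 0" if "\<alpha> \<notin> range ?u" for \<alpha>
  proof (cases "\<alpha> j")
    case (Suc k)
    then have "\<alpha> = ?u (\<alpha>(j := k))" by auto
    then show ?thesis using that by blast
  qed simp
  ultimately show ?thesis
    by (subst has_sum_cong_neutral[where S = "range ?u" and f = ?g, symmetric]) auto
qed

text \<open>The monomial estimate is uniform in the exponent and the coefficients have absolute
  value at most 1, so the ultrametric bound passes to the whole series.\<close>

lemma pseries_first_order:
  fixes f :: "'a::nonarch_absval_ring ^ 'n \<Rightarrow> 'a ^ 'n"
  assumes le1: "\<And>r :: 'a. absval r \<le> 1" and f: "defined_by_pseries f c"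
    and J: "has_jacobian_at c J x0"
    and x: "vec_absval (x - x0) \<le> l" and h: "vec_absval h \<le> M" and M: "0 \<le> M" "M \<le> l"
  shows "vec_absval (f (x + h) - f x - J *v h) \<le> l * M"
  unfolding vec_absval_le_iff
proof
  fix i
  let ?D = "\<lambda>j \<alpha>. of_nat (\<alpha> j) * x0 $ j ^ (\<alpha> j - 1) * (\<Prod>k\<in>UNIV - {j}. x0 $ k ^ \<alpha> k)"
  let ?m = "\<lambda>x \<alpha>. \<Prod>j\<in>UNIV. x $ j ^ \<alpha> j"
  have F: "((\<lambda>\<alpha>. c i \<alpha> * ?m y \<alpha>) has_sum f y $ i) UNIV" for y
    using f by (simp add: defined_by_pseries_def pseries_has_value_def)
  \<comment> \<open>Writing \<open>J *v h\<close> as a sum over exponents lets it be subtracted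
    monomial by monomial.\<close>
  have "((\<lambda>\<alpha>. \<Sum>j\<in>UNIV. c i \<alpha> * ?D j \<alpha> * h $ j) has_sum (\<Sum>j\<in>UNIV. J $ i $ j * h $ j)) UNIV"
    using J unfolding has_jacobian_at_def
    by (intro has_sum_sum_family has_sum_mult_right has_sum_pseries_partial) auto
  then have "((\<lambda>\<alpha>. c i \<alpha> * ?m (x + h) \<alpha> - c i \<alpha> * ?m x \<alpha> - (\<Sum>j\<in>UNIV. c i \<alpha> * ?D j \<alpha> * h $ j))
      has_sum (f (x + h) $ i - f x $ i - (\<Sum>j\<in>UNIV. J $ i $ j * h $ j))) UNIV"
    by (intro has_sum_minus F)
  then have "absval (f (x + h) $ i - f x $ i - (\<Sum>j\<in>UNIV. J $ i $ j * h $ j)) \<le> l * M"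
  proof (rule absval_has_sum_le)
    fix \<alpha> :: "'n \<Rightarrow> nat"
    \<comment> \<open>A coordinate is linear, so its first-order error is zero.\<close>
    have "first_order l M ((x + h) $ j) (x $ j) (x0 $ j) (h $ j)" for j
      using x h M by (simp add: first_order_def vec_absval_le_iff)
    then have "first_order l M (?m (x + h) \<alpha>) (?m x \<alpha>) (?m x0 \<alpha>)
        (\<Sum>j\<in>UNIV. of_nat (\<alpha> j) * x0 $ j ^ (\<alpha> j - 1) * h $ j * (\<Prod>k\<in>UNIV - {j}. x0 $ k ^ \<alpha> k))"
      by (intro first_order_prod[OF le1 M] first_order_power[OF le1 M]) auto
    then have "absval (?m (x + h) \<alpha> - ?m x \<alpha> - (\<Sum>j\<in>UNIV. ?D j \<alpha> * h $ j)) \<le> l * M"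
      by (simp add: first_order_def mult.assoc mult.commute mult.left_commute)
    from absval_mult_le[OF le1[of "c i \<alpha>"] this]
    show "absval (c i \<alpha> * ?m (x + h) \<alpha> - c i \<alpha> * ?m x \<alpha>
        - (\<Sum>j\<in>UNIV. c i \<alpha> * ?D j \<alpha> * h $ j)) \<le> l * M"
      by (simp add: right_diff_distrib sum_distrib_left mult.assoc)
  qed (use M in simp)
  then show "absval ((f (x + h) - f x - J *v h) $ i) \<le> l * M"
    by (simp add: matrix_vector_mult_def)
qed

text \<open>This serves as the continuity of \<open>f\<close> when passing to the limit of the
  iteration.\<close>

lemma pseries_lipschitz:
  fixes f :: "'a::nonarch_absval_ring ^ 'n \<Rightarrow> 'a ^ 'n"
  assumes le1: "\<And>r :: 'a. absval r \<le> 1" and f: "defined_by_pseries f c"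
    and xy: "vec_absval (y - x) \<le> r" and r: "0 \<le> r"
  shows "vec_absval (f y - f x) \<le> r"
  unfolding vec_absval_le_iff
proof
  fix i
  let ?m = "\<lambda>x \<alpha>. \<Prod>j\<in>UNIV. x $ j ^ \<alpha> j"
  have "((\<lambda>\<alpha>. c i \<alpha> * ?m z \<alpha>) has_sum f z $ i) UNIV" for z
    using f by (simp add: defined_by_pseries_def pseries_has_value_def)
  then have "((\<lambda>\<alpha>. c i \<alpha> * ?m y \<alpha> - c i \<alpha> * ?m x \<alpha>) has_sum f y $ i - f x $ i) UNIV"
    by (intro has_sum_minus)
  then have "absval (f y $ i - f x $ i) \<le> r"
  proof (rule absval_has_sum_le)
    fix \<alpha> :: "'n \<Rightarrow> nat"
    have "absval (?m y \<alpha> - ?m x \<alpha>) \<le> r"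
      using xy r by (intro absval_prod_diff_le[OF le1] absval_power_diff_le[OF le1])
        (auto simp: vec_absval_le_iff)
    from absval_mult_le[OF le1[of "c i \<alpha>"] this]
    show "absval (c i \<alpha> * ?m y \<alpha> - c i \<alpha> * ?m x \<alpha>) \<le> r"
      by (simp add: right_diff_distrib)
  qed (rule r)
  then show "absval ((f y - f x) $ i) \<le> r" by simp
qed

section \<open>Newton iteration with a fixed matrix\<close>

theorem theorem5p14:
  fixes f :: "'a::nonarch_absval_ring ^ 'n \<Rightarrow> 'a ^ 'n"
    and c :: "'n \<Rightarrow> ('n \<Rightarrow> nat) \<Rightarrow> 'a"
    and x0 :: "'a ^ 'n"
    and T J :: "'a ^ 'n ^ 'n"
    and l :: real
    and x :: "nat \<Rightarrow> 'a ^ 'n"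
  assumes "is_local_ring TYPE('a)"
    and "\<And>r :: 'a. absval r \<le> 1"
    and "defined_by_pseries f c"
    and "invertible T"
    and "0 \<le> l" and "l < 1"
    and "vec_absval (f x0) \<le> l"
    and "has_jacobian_at c J x0" and "mat_absval (T - J) \<le> l"
    and "x 0 = x0"
    and "\<And>m. x (Suc m) = x m - matrix_inv T *v f (x m)"
  shows "(\<forall>m. vec_absval (f (x m)) \<le> l ^ (m + 1) \<and> vec_absval (x m - x0) < 1)
    \<and> (complete (UNIV :: 'a set) \<longrightarrow> (\<exists>z. x \<longlonglongrightarrow> z \<and> f z = 0))"
proof -
  note le1 = assms(2) and f = assms(3) and l = assms(5,6) and J = assms(8) and step = assms(11)
  \<comment> \<open>The entries of \<open>matrix_inv T\<close> lie in the ring, so it has norm at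
    most 1 and a step is no larger than the value of \<open>f\<close>.\<close>
  have small: "vec_absval (x (Suc m) - x m) \<le> r" if "vec_absval (f (x m)) \<le> r" for m r
    using matrix_vector_mult_absval_le[of "matrix_inv T" 1, OF _ that] le1
    by (simp add: step mat_absval_le_iff vec_absval_le_iff)
  have le_l: "l ^ (m + 1) \<le> l" for m
    using l by (simp add: mult_left_le power_le_one)
  \<comment> \<open>The bound \<open>l\<close> replaces the strict bound 1 because the first-order
    estimate needs \<open>x m\<close> within \<open>l\<close> of \<open>x0\<close>.\<close>
  have main: "vec_absval (f (x m)) \<le> l ^ (m + 1) \<and> vec_absval (x m - x0) \<le> l" for m
  proof (induction m)
    case 0
    then show ?case using assms(7,10) l by (simp add: vec_absval_le_iff)
  next
    case (Suc m)
    define h where "h = x (Suc m) - x m"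
    have h: "vec_absval h \<le> l ^ (m + 1)"
      using small Suc unfolding h_def by blast
    have "T *v h = T *v (0 - matrix_inv T *v f (x m))"
      by (simp add: h_def step)
    also have "\<dots> = - f (x m)"
      by (simp only: matrix_vector_mult_diff_distrib matrix_vector_mul_assoc
          mult_matrix_inv[OF assms(4)]) simp
    finally have "T *v h = - f (x m)" .
    \<comment> \<open>The terms \<open>J *v h\<close> cancel, and what is left,
      \<open>- f (x m) - T *v h\<close>, is zero.\<close>
    then have "f (x (Suc m)) = (f (x m + h) - f (x m) - J *v h) - (T - J) *v h"
      by (simp add: h_def matrix_vector_mult_diff_rdistrib)
    also have "vec_absval \<dots> \<le> l * l ^ (m + 1)"
    proof (rule vec_absval_diff_le)
      show "vec_absval (f (x m + h) - f (x m) - J *v h) \<le> l * l ^ (m + 1)"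
        using Suc h l le_l[of m] by (intro pseries_first_order[OF le1 f J]) auto
      show "vec_absval ((T - J) *v h) \<le> l * l ^ (m + 1)"
        by (rule matrix_vector_mult_absval_le[OF assms(9) h])
    qed
    finally have "vec_absval (f (x (Suc m))) \<le> l ^ (Suc m + 1)" by simp
    moreover have "vec_absval (x (Suc m) - x0) \<le> l"
    proof -
      have "vec_absval (h + (x m - x0)) \<le> l"
        using order_trans[OF h le_l] Suc by (intro vec_absval_add_le) auto
      then show ?thesis by (simp add: h_def)
    qed
    ultimately show ?case by blast
  qed
  moreover have "\<exists>z. x \<longlonglongrightarrow> z \<and> f z = 0" if complete: "complete (UNIV :: 'a set)"
  proof -
    \<comment> \<open>The ultrametric inequality bounds the total displacement by the largest single
      step, the first one, so no geometric series appears.\<close>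
    have tail: "vec_absval (x (m + k) - x m) \<le> l ^ (m + 1)" for m k
    proof (induction k)
      case 0
      then show ?case using l by (simp add: vec_absval_le_iff)
    next
      case (Suc k)
      have "l ^ (m + k + 1) \<le> l ^ (m + 1)"
        using l by (intro power_decreasing) auto
      then have "vec_absval (x (Suc (m + k)) - x (m + k)) \<le> l ^ (m + 1)"
        using small[of "m + k" "l ^ (m + k + 1)"] main[of "m + k"] by simp
      from vec_absval_add_le[OF this Suc] show ?case by simp
    qed
    have lim0: "(\<lambda>m. l ^ (m + 1)) \<longlonglongrightarrow> 0"
      using l by (intro LIMSEQ_ignore_initial_segment LIMSEQ_power_zero) simp
    \<comment> \<open>Completeness is given for the ring, so limits are taken
      coordinatewise.\<close>
    have "\<exists>z. (\<lambda>m. x m $ i) \<longlonglongrightarrow> z" for i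
    proof -
      have "Cauchy (\<lambda>m. x m $ i)"
      proof (rule CauchyI')
        fix e :: real
        assume "0 < e"
        then obtain m where m: "l ^ (m + 1) < e"
          using order_tendstoD(2)[OF lim0] eventually_happens'[OF sequentially_bot] by blast
        have "dist (x m' $ i) (x n $ i) < e" if "m' \<ge> m" "n > m'" for m' n
        proof -
          have "absval (x n $ i - x m' $ i) \<le> l ^ (m' + 1)"
            using tail[of m' "n - m'"] that by (simp add: vec_absval_le_iff)
          also have "\<dots> \<le> l ^ (m + 1)"
            using l that by (intro power_decreasing) auto
          finally show ?thesis
            using m by (metis dist_absval dist_commute le_less_trans)
        qed
        then show "\<exists>m. \<forall>m'\<ge>m. \<forall>n>m'. dist (x m' $ i) (x n $ i) < e" by blast
      qed
      then show ?thesis using complete unfolding complete_def by auto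
    qed
    then obtain z where z: "\<And>i. (\<lambda>m. x m $ i) \<longlonglongrightarrow> z i" by metis
    define w where "w = (\<chi> i. z i)"
    have "vec_absval (f w) \<le> l ^ (m + 1)" for m
    proof -
      \<comment> \<open>Let \<open>k\<close> tend to infinity in \<open>tail\<close>; closed balls
        contain their limits.\<close>
      have "vec_absval (w - x m) \<le> l ^ (m + 1)"
        unfolding vec_absval_le_iff
      proof
        fix i
        have "z i \<in> {y. absval (y - x m $ i) \<le> l ^ (m + 1)}"
          using tail[of m] LIMSEQ_ignore_initial_segment[OF z[of i], of m]
          by (intro Lim_in_closed_set[OF closed_absval_diff_le, where F = sequentially])
            (auto simp: vec_absval_le_iff add.commute)
        then show "absval ((w - x m) $ i) \<le> l ^ (m + 1)" by (simp add: w_def)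
      qed
      then have "vec_absval (f w - f (x m)) \<le> l ^ (m + 1)"
        using l by (intro pseries_lipschitz[OF le1 f]) auto
      from vec_absval_add_le[OF this, of "f (x m)"] main[of m] show ?thesis by simp
    qed
    \<comment> \<open>The bound holds for every \<open>m\<close>, and its right-hand side tends to
      0.\<close>
    then have "absval (f w $ i) \<le> 0" for i
      using LIMSEQ_le_const[OF lim0, of "absval (f w $ i)"] by (simp add: vec_absval_le_iff)
    then have "f w = 0"
      using absval_nonneg by (metis absval_eq_0_iff order_antisym vec_eq_iff zero_index)
    moreover have "x \<longlonglongrightarrow> w"
      using z by (intro vec_tendstoI) (simp add: w_def)
    ultimately show ?thesis by blast
  qed
  ultimately show ?thesis
    by (auto intro: le_less_trans[OF _ l(2)])
qed

end
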